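(* Let $g_4:\{\texttt{0},\texttt{1},\texttt{2}\}^*\to\{\texttt{0},\texttt{1}\}^*$ be the morphism $g_4(\texttt{0})=\texttt{00010011000111011}$, $g_4(\texttt{1})=\texttt{000100111011}$, $g_4(\texttt{2})=\texttt{00111}$. Every bi-infinite binary word whose only square factors are $\texttt{00}$, $\texttt{11}$, $\texttt{001001}$ and $\texttt{110110}$ has the same set of finite factors as $g_4(b_3)$.
   Context: $b_3$ is the Hall–Thue word, the fixed point starting with $\texttt{0}$ of the morphism $\texttt{0}\mapsto\texttt{012}$, $\texttt{1}\mapsto\texttt{02}$, $\texttt{2}\mapsto\texttt{1}$. A square is a nonempty word of the form $uu$. *)

theory Defs
  imports "HOL-Library.Stream"
begin

datatype binary = B0 | B1
datatype ternary = T0 | T1 | T2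

text \<open>
  A non-erasing morphism is given by its letter images \<open>f\<close>. On right-infinite words it acts by
  concatenating the images of the letters; \<^const>\<open>flat\<close> expresses this only if no \<open>f a\<close> is empty.
\<close>

definition morph_inf :: "('a \<Rightarrow> 'b list) \<Rightarrow> 'a stream \<Rightarrow> 'b stream" where
  "morph_inf f s = flat (smap f s)"

fun hall_thue :: "ternary \<Rightarrow> ternary list" where
  "hall_thue T0 = [T0, T1, T2]"
| "hall_thue T1 = [T0, T2]"
| "hall_thue T2 = [T1]"

fun g4 :: "ternary \<Rightarrow> binary list" where
  "g4 T0 = [B0, B0, B0, B1, B0, B0, B1, B1, B0, B0, B0, B1, B1, B1, B0, B1, B1]"
| "g4 T1 = [B0, B0, B0, B1, B0, B0, B1, B1, B1, B0, B1, B1]"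
| "g4 T2 = [B0, B0, B1, B1, B1]"

definition b3 :: "ternary stream" where
  "b3 = (THE s. shd s = T0 \<and> morph_inf hall_thue s = s)"

definition factors_inf :: "'a stream \<Rightarrow> 'a list set" where
  "factors_inf s = {stake n (sdrop i s) | i n. True}"

definition factors_biinf :: "(int \<Rightarrow> 'a) \<Rightarrow> 'a list set" where
  "factors_biinf w = {map w [i..j] | i j. True}"

definition is_square :: "'a list \<Rightarrow> bool" where
  "is_square x \<longleftrightarrow> (\<exists>u. u \<noteq> [] \<and> x = u @ u)"

text \<open>The rest of the theory shows that the description of \<^const>\<open>b3\<close> is proper.\<close>

lemma hall_thue_ne: "hall_thue a \<noteq> []"
  by (cases a) auto

lemma g4_ne: "g4 a \<noteq> []"
  by (cases a) auto

lemma morph_inf_SCons: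
  assumes "f a \<noteq> []"
  shows "morph_inf f (a ## s) = f a @- morph_inf f s"
  using assms by (simp add: morph_inf_def flat_Stream)

lemma morph_inf_shift:
  assumes "\<And>a. f a \<noteq> []"
  shows "morph_inf f (xs @- s) = concat (map f xs) @- morph_inf f s"
  by (induction xs) (simp_all add: morph_inf_SCons assms)

definition ht_iter :: "nat \<Rightarrow> ternary list" where
  "ht_iter n = ((\<lambda>xs. concat (map hall_thue xs)) ^^ n) [T0]"

lemma ht_iter_0: "ht_iter 0 = [T0]"
  by (simp add: ht_iter_def)

lemma ht_iter_Suc: "ht_iter (Suc n) = concat (map hall_thue (ht_iter n))"
  by (simp add: ht_iter_def)

lemma ht_iter_ext: "\<exists>ys. ys \<noteq> [] \<and> ht_iter (Suc n) = ht_iter n @ ys"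
proof (induction n)
  case 0
  show ?case by (simp add: ht_iter_0 ht_iter_Suc)
next
  case (Suc n)
  then obtain ys where ys: "ys \<noteq> []" "ht_iter (Suc n) = ht_iter n @ ys"
    by blast
  have "ht_iter (Suc (Suc n)) = ht_iter (Suc n) @ concat (map hall_thue ys)"
    using ys(2) by (metis concat_append ht_iter_Suc map_append)
  moreover have "concat (map hall_thue ys) \<noteq> []"
    using ys(1) hall_thue_ne by (cases ys) auto
  ultimately show ?case by blast
qed

lemma length_ht_iter: "n < length (ht_iter n)"
proof (induction n)
  case 0
  show ?case by (simp add: ht_iter_0)
next
  case (Suc n)
  obtain ys where "ys \<noteq> []" "ht_iter (Suc n) = ht_iter n @ ys"
    using ht_iter_ext by blast
  with Suc show ?case by (cases ys) auto
qed

lemma ht_iter_nth: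
  assumes "m \<le> n" "k < length (ht_iter m)"
  shows "ht_iter n ! k = ht_iter m ! k \<and> k < length (ht_iter n)"
  using assms
proof (induction n rule: dec_induct)
  case (step n)
  obtain ys where "ht_iter (Suc n) = ht_iter n @ ys"
    using ht_iter_ext by blast
  with step show ?case by (simp add: nth_append)
qed simp

definition ht_limit :: "ternary stream" where
  "ht_limit = smap (\<lambda>n. ht_iter n ! n) nats"

lemma ht_limit_prefix: "stake (length (ht_iter n)) ht_limit = ht_iter n"
proof (rule nth_equalityI)
  fix k assume "k < length (stake (length (ht_iter n)) ht_limit)"
  then have k: "k < length (ht_iter n)" by simp
  have "ht_iter k ! k = ht_iter n ! k"
    using ht_iter_nth[of k n k] ht_iter_nth[of n k k] length_ht_iter[of k] k
    by (cases "k \<le> n") auto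
  with k show "stake (length (ht_iter n)) ht_limit ! k = ht_iter n ! k"
    by (simp add: ht_limit_def)
qed simp

lemma stream_eq_stakeI:
  assumes "\<And>n. \<exists>m\<ge>n. stake m s = stake m t"
  shows "s = t"
proof -
  have "s !! k = t !! k" for k
  proof -
    obtain m where "m \<ge> Suc k" "stake m s = stake m t"
      using assms by blast
    then show ?thesis by (metis Suc_le_lessD stake_nth)
  qed
  then show ?thesis by (metis smap_alt stream.map_ident)
qed

lemma stake_shift_length: "stake (length xs) (xs @- s) = xs"
  by (simp add: stake_shift)

lemma ht_fixed_prefix:
  assumes "shd s = T0" "morph_inf hall_thue s = s"
  shows "\<exists>t. s = ht_iter n @- t"
proof (induction n)
  case 0
  show ?case using assms(1) by (metis ht_iter_0 shift.simps stream.collapse)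
next
  case (Suc n)
  then show ?case
    using assms(2) morph_inf_shift[of hall_thue, OF hall_thue_ne] ht_iter_Suc by metis
qed

lemma b3_ex1: "\<exists>!s. shd s = T0 \<and> morph_inf hall_thue s = s"
proof (rule ex1I)
  have "shd ht_limit = T0"
    by (simp add: ht_limit_def ht_iter_0)
  moreover have "morph_inf hall_thue ht_limit = ht_limit"
  proof (rule stream_eq_stakeI)
    fix n
    let ?m = "length (ht_iter (Suc n))"
    have "ht_limit = ht_iter n @- sdrop (length (ht_iter n)) ht_limit"
      by (metis ht_limit_prefix stake_sdrop)
    then have "morph_inf hall_thue ht_limit =
        ht_iter (Suc n) @- morph_inf hall_thue (sdrop (length (ht_iter n)) ht_limit)"
      using morph_inf_shift[of hall_thue, OF hall_thue_ne] ht_iter_Suc by metis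
    then have "stake ?m (morph_inf hall_thue ht_limit) = stake ?m ht_limit"
      using stake_shift_length ht_limit_prefix by metis
    moreover have "n \<le> ?m" using length_ht_iter[of "Suc n"] by simp
    ultimately show "\<exists>m\<ge>n. stake m (morph_inf hall_thue ht_limit) = stake m ht_limit"
      by blast
  qed
  ultimately show "shd ht_limit = T0 \<and> morph_inf hall_thue ht_limit = ht_limit" ..
next
  fix s assume s: "shd s = T0 \<and> morph_inf hall_thue s = s"
  show "s = ht_limit"
  proof (rule stream_eq_stakeI)
    fix n
    obtain t where "s = ht_iter n @- t"
      using ht_fixed_prefix s by blast
    then have "stake (length (ht_iter n)) s = stake (length (ht_iter n)) ht_limit"
      using stake_shift_length ht_limit_prefix by metis
    moreover have "n \<le> length (ht_iter n)" using length_ht_iter[of n] by simp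
    ultimately show "\<exists>m\<ge>n. stake m s = stake m ht_limit" by blast
  qed
qed

lemma b3_fixed: "shd b3 = T0" "morph_inf hall_thue b3 = b3"
  using theI'[OF b3_ex1] by (simp_all add: b3_def)

end

theory Submission
  imports Defs "HOL-Library.Sublist"
begin

text \<open>
  A finite backtracking search shows that \<open>w\<close> splits into blocks \<open>g4 a\<close>, so \<open>w\<close> is the image of a
  bi-infinite ternary word \<open>t\<close>. This \<open>t\<close> is square-free and avoids 010 and 212, since otherwise its
  image would contain a long square. By Thue's argument such a word is the \<open>hall_thue\<close>-image of
  another word of the same kind. Hence for every \<open>n\<close> the word \<open>w\<close> is the image of some such word
  \<open>t\<^sub>n\<close> under \<open>g4 \<circ> hall_thue\<^sup>n\<close>. For large \<open>n\<close>, a given factor of \<open>w\<close> lies in the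
  image of two distinct adjacent letters, all pairs of which occur in \<open>b3\<close>; conversely, a given factor
  of \<open>g4(b3)\<close> lies in the image of 0, which occurs in \<open>t\<^sub>n\<close>.
\<close>

section \<open>Occurrences in bi-infinite words\<close>

text \<open>The recursive form lets the simplifier turn an occurrence of a concrete word into
  equations between single letters.\<close>

fun occurs :: "(int \<Rightarrow> 'a) \<Rightarrow> int \<Rightarrow> 'a list \<Rightarrow> bool" where
  "occurs w i [] \<longleftrightarrow> True"
| "occurs w i (a # u) \<longleftrightarrow> w i = a \<and> occurs w (i + 1) u"

lemma occurs_append:
  "occurs w i (u @ v) \<longleftrightarrow> occurs w i u \<and> occurs w (i + int (length u)) v"
  by (induction u arbitrary: i) (auto simp: add.assoc add.commute)

lemma occurs_map_upto: "occurs w i u \<longleftrightarrow> u = map w [i..i + int (length u) - 1]"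
proof (induction u arbitrary: i)
  case (Cons a u)
  have "[i..i + int (length (a # u)) - 1] = i # [i + 1..i + 1 + int (length u) - 1]"
    by (subst upto_rec1) auto
  with Cons[of "i + 1"] show ?case by auto
qed simp

lemma factors_biinf_occurs: "u \<in> factors_biinf w \<longleftrightarrow> (\<exists>i. occurs w i u)"
proof
  assume "u \<in> factors_biinf w"
  then obtain i j where u: "u = map w [i..j]"
    by (auto simp: factors_biinf_def)
  then have "occurs w i u"
    by (cases "i \<le> j") (simp_all add: occurs_map_upto)
  then show "\<exists>i. occurs w i u" ..
qed (auto simp: factors_biinf_def occurs_map_upto)

lemma occurs_sublist:
  assumes "occurs w i v" "sublist u v"
  shows "\<exists>j. occurs w j u"
  using assms by (auto simp: sublist_def occurs_append)

lemma occurs_prefix: "occurs w i v \<Longrightarrow> prefix u v \<Longrightarrow> occurs w i u"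
  by (auto simp: prefix_def occurs_append)

lemma occurs_suffix:
  assumes "occurs w (c - int (length v)) v" "suffix u v"
  shows "occurs w (c - int (length u)) u"
  using assms by (auto simp: suffix_def occurs_append)

lemma occurs_sublist_of_longer:
  assumes "occurs w i v" "occurs w j u" "i \<le> j" "j + int (length u) \<le> i + int (length v)"
  shows "sublist u v"
proof -
  define k where "k = nat (j - i)"
  have k: "j = i + int k" "k + length u \<le> length v"
    using assms(3,4) by (auto simp: k_def)
  define x y z where "x = take k v" and "y = take (length u) (drop k v)"
    and "z = drop (length u) (drop k v)"
  have v: "v = x @ y @ z"
    by (simp add: x_def y_def z_def del: drop_drop)
  have len: "length x = k" "length y = length u"
    using k(2) by (auto simp: x_def y_def)
  have "occurs w j y"
    using assms(1) len k(1) by (simp add: v occurs_append)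
  then have "y = u"
    using assms(2) len by (metis occurs_map_upto)
  then show ?thesis
    using v by (auto simp: sublist_def)
qed

section \<open>Desubstitution\<close>

text \<open>Block \<open>i\<close> fills the positions from \<open>p i\<close> up to but excluding
  \<open>p (i + 1)\<close>. Carrying \<open>p\<close> along avoids shifting \<open>w\<close> so that
  a block starts at 0.\<close>

definition desubst ::
  "('a \<Rightarrow> 'b list) \<Rightarrow> (int \<Rightarrow> 'b) \<Rightarrow> (int \<Rightarrow> 'a) \<Rightarrow> (int \<Rightarrow> int) \<Rightarrow> bool" where
  "desubst f w t p \<longleftrightarrow>
     (\<forall>i. occurs w (p i) (f (t i)) \<and> p (i + 1) = p i + int (length (f (t i))))"

text \<open>Starting from one cut, choice functions select a block to the right and a block to the
  left of every cut reached; the two one-sided parsings are glued at \<open>c\<close>.\<close>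

lemma desubst_exists:
  assumes c: "c \<in> C"
    and fwd: "\<And>c. c \<in> C \<Longrightarrow> \<exists>a. occurs w c (f a) \<and> c + int (length (f a)) \<in> C"
    and bwd: "\<And>c. c \<in> C \<Longrightarrow>
      \<exists>a. occurs w (c - int (length (f a))) (f a) \<and> c - int (length (f a)) \<in> C"
  shows "\<exists>t p. desubst f w t p"
proof -
  obtain next_a where next_a: "\<And>c. c \<in> C \<Longrightarrow> occurs w c (f (next_a c)) \<and>
      c + int (length (f (next_a c))) \<in> C"
    using fwd by metis
  obtain prev_a where prev_a: "\<And>c. c \<in> C \<Longrightarrow>
      occurs w (c - int (length (f (prev_a c)))) (f (prev_a c)) \<and>
      c - int (length (f (prev_a c))) \<in> C"
    using bwd by metis
  define R where "R n = ((\<lambda>c. c + int (length (f (next_a c)))) ^^ n) c" for n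
  define L where "L n = ((\<lambda>c. c - int (length (f (prev_a c)))) ^^ n) c" for n
  have R: "R n \<in> C" for n
    by (induction n) (auto simp: R_def c next_a)
  have L: "L n \<in> C" for n
    by (induction n) (auto simp: L_def c prev_a)
  define p where "p i = (if i \<ge> 0 then R (nat i) else L (nat (- i)))" for i
  \<comment> \<open>For negative \<open>i\<close>, the block is found from its right end, the cut
    \<open>L (- i - 1)\<close>, because \<open>prev_a\<close> looks backwards.\<close>
  define t where "t i = (if i \<ge> 0 then next_a (R (nat i)) else prev_a (L (nat (- i - 1))))" for i
  have "occurs w (p i) (f (t i)) \<and> p (i + 1) = p i + int (length (f (t i)))" for i
  proof (cases "i \<ge> 0")
    case True
    then have "nat (i + 1) = Suc (nat i)" by simp
    with True show ?thesis
      using next_a[OF R] by (simp add: p_def t_def R_def)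
  next
    case False
    define k where "k = nat (- i - 1)"
    have k: "nat (- i) = Suc k" "nat (- i - 1) = k" "i = - int k - 1"
      using False by (auto simp: k_def)
    have "p (i + 1) = L k"
      by (cases "k = 0") (auto simp: p_def k(3) R_def L_def)
    moreover have "p i = L (Suc k)" "t i = prev_a (L k)"
      using False by (simp_all add: p_def t_def k(1,2))
    ultimately show ?thesis
      using prev_a[OF L, of k] by (simp add: L_def)
  qed
  then show ?thesis
    unfolding desubst_def by blast
qed

lemma desubst_occurs:
  assumes "desubst f w t p" "occurs t i u"
  shows "occurs w (p i) (concat (map f u)) \<and>
    p (i + int (length u)) = p i + int (length (concat (map f u)))"
  using assms(2)
proof (induction u arbitrary: i)
  case (Cons a u)
  then have "t i = a" "occurs t (i + 1) u" by auto
  moreover have "p (i + 1) = p i + int (length (f (t i)))" "occurs w (p i) (f (t i))"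
    using assms(1) by (auto simp: desubst_def)
  ultimately show ?case
    using Cons.IH[of "i + 1"] by (simp add: occurs_append add.assoc)
qed simp

lemma desubst_compose:
  assumes "desubst f w t p" "desubst g t s q"
  shows "desubst (\<lambda>a. concat (map f (g a))) w s (\<lambda>i. p (q i))"
proof -
  have "occurs t (q i) (g (s i))" "q (i + 1) = q i + int (length (g (s i)))" for i
    using assms(2) by (auto simp: desubst_def)
  with desubst_occurs[OF assms(1)] show ?thesis
    by (auto simp: desubst_def)
qed

text \<open>Nonempty blocks make \<open>p\<close> grow by at least 1 per step, so it is unbounded on
  both sides; the block sought ends at the first boundary beyond \<open>j\<close>.\<close>

lemma desubst_block:
  assumes d: "desubst f w t p" and ne: "\<And>a. f a \<noteq> []"
  shows "\<exists>i. p i \<le> j \<and> j < p (i + 1)"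
proof -
  have step: "p i + 1 \<le> p (i + 1)" for i
    using d ne[of "t i"] by (cases "f (t i)") (auto simp: desubst_def)
  have far: "p i + int n \<le> p (i + int n)" for i n
  proof (induction n)
    case (Suc n)
    with step[of "i + int n"] show ?case by (simp add: algebra_simps)
  qed simp
  define m where "m = nat \<bar>j - p 0\<bar> + 1"
  have lo: "p (- int m) \<le> j"
    using far[of "- int m" m] by (simp add: m_def)
  have hi: "j < p (- int m + int (2 * m))"
    using far[of 0 m] by (simp add: m_def)
  define n where "n = (LEAST n. j < p (- int m + int n))"
  have n: "j < p (- int m + int n)"
    unfolding n_def using hi by (rule LeastI)
  with lo have "n \<noteq> 0" by (cases n) auto
  then obtain k where k: "n = Suc k" by (cases n) auto
  then have "\<not> j < p (- int m + int k)"
    using not_less_Least[of k "\<lambda>n. j < p (- int m + int n)"] by (simp add: n_def)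
  with n show ?thesis
    by (intro exI[of _ "- int m + int k"]) (simp add: k algebra_simps)
qed

lemma desubst_two_blocks:
  assumes d: "desubst f w t p" and ne: "\<And>a. f a \<noteq> []"
    and len: "\<And>a. length v \<le> length (f a)" and v: "occurs w j v"
  shows "\<exists>i. sublist v (f (t i) @ f (t (i + 1)))"
proof -
  obtain i where i: "p i \<le> j" "j < p (i + 1)"
    using desubst_block[OF d ne] by blast
  have "occurs w (p i) (f (t i) @ f (t (i + 1)))"
    using d by (simp add: desubst_def occurs_append flip: add.assoc) (metis)
  then have "sublist v (f (t i) @ f (t (i + 1)))"
  proof (rule occurs_sublist_of_longer[OF _ v i(1)])
    have "p (i + 1) = p i + int (length (f (t i)))"
      using d by (simp add: desubst_def)
    with i(2) len[of "t (i + 1)"]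
    show "j + int (length v) \<le> p i + int (length (f (t i) @ f (t (i + 1))))"
      by simp
  qed
  then show ?thesis ..
qed

section \<open>Square-free ternary words avoiding 010 and 212\<close>

definition square_free :: "(int \<Rightarrow> 'a) \<Rightarrow> bool" where
  "square_free t \<longleftrightarrow> (\<forall>i u. occurs t i (u @ u) \<longrightarrow> u = [])"

definition thue_word :: "(int \<Rightarrow> ternary) \<Rightarrow> bool" where
  "thue_word t \<longleftrightarrow> square_free t \<and>
     (\<forall>i. \<not> occurs t i [T0, T1, T0] \<and> \<not> occurs t i [T2, T1, T2])"

lemma square_freeD: "square_free t \<Longrightarrow> occurs t i (u @ u) \<Longrightarrow> u = []"
  by (simp add: square_free_def)

lemma square_free_adjacent: "square_free t \<Longrightarrow> t i \<noteq> t (i + 1)"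
  using square_freeD[of t i "[t i]"] by auto

lemma square_free_period_2:
  "square_free t \<Longrightarrow> t i = t (i + 2) \<Longrightarrow> t (i + 1) \<noteq> t (i + 3)"
  using square_freeD[of t i "[t i, t (i + 1)]"] by (auto simp: add.assoc)

text \<open>A neighbour of \<open>aba\<close> equal to \<open>a\<close> would give
  \<open>aa\<close>, and one equal to \<open>b\<close> would give \<open>baba\<close> or
  \<open>abab\<close>. This replaces 212 by 02120, whose image contains a forbidden square.\<close>

lemma square_free_aba:
  fixes t :: "int \<Rightarrow> ternary"
  assumes sf: "square_free t" and aba: "occurs t i [a, b, a]" and c: "c \<noteq> a" "c \<noteq> b"
  shows "occurs t (i - 1) [c, a, b, a, c]"
proof -
  have t: "t i = a" "t (i + 1) = b" "t (i + 2) = a"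
    using aba by (auto simp: add.assoc)
  have i: "i - 1 + 1 = i" "i - 1 + 2 = i + 1" "i - 1 + 3 = i + 2" "i + 2 + 1 = i + 3"
    by simp_all
  have "a \<noteq> b" "t (i - 1) \<noteq> a" "t (i + 3) \<noteq> a" "t (i - 1) \<noteq> b" "t (i + 3) \<noteq> b"
    using square_free_adjacent[OF sf, of i] square_free_adjacent[OF sf, of "i - 1"]
      square_free_adjacent[OF sf, of "i + 2"] square_free_period_2[OF sf, of i]
      square_free_period_2[OF sf, of "i - 1"] t unfolding i by auto
  with c t have "t (i - 1) = c" "t (i + 3) = c"
    by (metis ternary.exhaust)+
  with t show ?thesis by (simp add: add.assoc)
qed

lemma square_free_T0:
  assumes sf: "square_free t"
  shows "\<exists>i. t i = T0"
proof (rule ccontr)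
  assume "\<nexists>i. t i = T0"
  then have no: "t i \<noteq> T0" for i by blast
  have "t 0 = t 2 \<and> t 1 = t 3"
    using square_free_adjacent[OF sf, of 0] square_free_adjacent[OF sf, of 1]
      square_free_adjacent[OF sf, of 2] no
    by simp (metis ternary.exhaust)
  with square_free_period_2[OF sf, of 0] show False by simp
qed

lemma square_free_image_square:
  assumes "desubst f w t p" "square_free w" "sublist (u @ u) (concat (map f x))" "u \<noteq> []"
  shows "\<not> occurs t i x"
  using desubst_occurs[OF assms(1)] occurs_sublist[OF _ assms(3)] square_freeD[OF assms(2)] assms(4)
  by blast

lemma square_free_desubst:
  assumes d: "desubst f w t p" and ne: "\<And>a. f a \<noteq> []" and sf: "square_free w"
  shows "square_free t"
  unfolding square_free_def
proof (intro allI impI, rule ccontr)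
  fix i u assume u: "occurs t i (u @ u)" "u \<noteq> []"
  then have "concat (map f u) \<noteq> []"
    using ne by (cases u) auto
  with square_free_image_square[OF d sf, of "concat (map f u)" "u @ u" i] u(1) show False
    by simp
qed

lemma thue_word_desubst:
  assumes th: "thue_word t"
  shows "\<exists>s q. desubst hall_thue t s q \<and> thue_word s"
proof -
  have sf: "square_free t" using th by (simp add: thue_word_def)
  have no010: "\<not> (t i = T0 \<and> t (i + 1) = T1 \<and> t (i + 2) = T0)"
    and no212: "\<not> (t i = T2 \<and> t (i + 1) = T1 \<and> t (i + 2) = T2)" for i
    using th by (auto simp: thue_word_def add.assoc)
  note adj = square_free_adjacent[OF sf]
  \<comment> \<open>The blocks 012, 02 and 1 are found by cutting before every 0 and after every 2.
    Avoiding 010 makes 01 continue to 012, and avoiding 212 leaves only 0 to follow 21.\<close>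
  define C where "C = {c. t c = T0 \<or> t c = T1 \<and> t (c - 1) = T2}"
  have C: "c \<in> C \<longleftrightarrow> t c = T0 \<or> t c = T1 \<and> t (c - 1) = T2" for c
    by (simp add: C_def)
  have after2: "i + 1 \<in> C" if "t i = T2" for i
    using that adj[of i] by (cases "t (i + 1)") (auto simp: C)
  have fwd: "\<exists>a. occurs t c (hall_thue a) \<and> c + int (length (hall_thue a)) \<in> C"
    if c: "c \<in> C" for c
  proof (cases "t c")
    case T0
    show ?thesis
    proof (cases "t (c + 1)")
      case T1
      then have "t (c + 2) = T2"
        using T0 adj[of "c + 1"] no010[of c] by (cases "t (c + 2)") (auto simp: add.assoc)
      with T0 T1 after2[of "c + 2"] show ?thesis
        by (intro exI[of _ T0]) (simp add: add.assoc)
    next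
      case T2
      with T0 after2[of "c + 1"] show ?thesis
        by (intro exI[of _ T1]) (simp add: add.assoc)
    qed (use T0 adj[of c] in auto)
  next
    case T1
    then have "t (c - 1) = T2" using c by (simp add: C)
    then have "t (c + 1) = T0"
      using T1 adj[of c] no212[of "c - 1"] by (cases "t (c + 1)") (auto simp: add.commute)
    with T1 show ?thesis
      by (intro exI[of _ T2]) (simp add: C)
  qed (use c in \<open>auto simp: C\<close>)
  have bwd: "\<exists>a. occurs t (c - int (length (hall_thue a))) (hall_thue a) \<and>
      c - int (length (hall_thue a)) \<in> C" if c: "c \<in> C" for c
  proof (cases "t (c - 1)")
    case T0
    with c adj[of "c - 1"] show ?thesis by (auto simp: C)
  next
    case T1
    then have "t c = T0" using c by (auto simp: C)
    with T1 have "t (c - 2) = T2"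
      using adj[of "c - 2"] no010[of "c - 2"] by (cases "t (c - 2)") auto
    with T1 show ?thesis
      by (intro exI[of _ T2]) (simp add: C)
  next
    case T2
    show ?thesis
    proof (cases "t (c - 2)")
      case T0
      with T2 show ?thesis
        by (intro exI[of _ T1]) (simp add: C)
    next
      case T1
      with T2 have "t (c - 3) = T0"
        using adj[of "c - 3"] no212[of "c - 3"] by (cases "t (c - 3)") auto
      with T1 T2 show ?thesis
        by (intro exI[of _ T0]) (simp add: C)
    qed (use T2 adj[of "c - 2"] in auto)
  qed
  obtain c where "c \<in> C"
    using square_free_T0[OF sf] by (auto simp: C)
  from desubst_exists[OF this fwd bwd]
  obtain s q where d: "desubst hall_thue t s q" by blast
  have sfs: "square_free s"
    using square_free_desubst[OF d hall_thue_ne sf] .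
  \<comment> \<open>The image 012.02.012 of 010 contains 2020, and the image 012.1.02.1.012 of 02120
    contains 210210.\<close>
  have "\<not> occurs s i [T0, T1, T0]" for i
    by (rule square_free_image_square[OF d sf, of "[T2, T0]"]) (simp_all add: sublist_Cons_right)
  moreover have "\<not> occurs s i [T0, T2, T1, T2, T0]" for i
    by (rule square_free_image_square[OF d sf, of "[T2, T1, T0]"])
      (simp_all add: sublist_Cons_right)
  then have "\<not> occurs s i [T2, T1, T2]" for i
    using square_free_aba[OF sfs] by blast
  ultimately show ?thesis
    using d sfs by (auto simp: thue_word_def)
qed

section \<open>Binary words with four squares\<close>

definition square_roots :: "binary list list" where
  "square_roots = [[B0], [B1], [B0, B0, B1], [B1, B1, B0]]"

definition few_squares :: "(int \<Rightarrow> binary) \<Rightarrow> bool" where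
  "few_squares w \<longleftrightarrow> (\<forall>i u. u \<noteq> [] \<longrightarrow> occurs w i (u @ u) \<longrightarrow> u \<in> set square_roots)"

text \<open>Equality of the two \<open>take\<close> terms already makes both halves have length
  \<open>p\<close>, except for empty \<open>x\<close>, which \<open>y \<noteq> []\<close>
  excludes.\<close>

definition square_prefix :: "'a list list \<Rightarrow> 'a list \<Rightarrow> bool" where
  "square_prefix A x \<longleftrightarrow> list_ex
     (\<lambda>p. let y = take p x in y = take p (drop p x) \<and> y \<noteq> [] \<and> y \<notin> set A) [1..<10]"

lemma square_prefixD:
  assumes "square_prefix A x"
  shows "\<exists>y z. x = y @ y @ z \<and> y \<noteq> [] \<and> y \<notin> set A"
proof -
  obtain p where p: "take p x = take p (drop p x)" "take p x \<noteq> []" "take p x \<notin> set A"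
    using assms unfolding square_prefix_def list_ex_iff Let_def by blast
  then have "x = take p x @ take p x @ drop p (drop p x)"
    by (metis append_take_drop_id)
  with p(2,3) show ?thesis by blast
qed

text \<open>
  Backtracking over the factors \<open>l @ r\<close> around a fixed position (between \<open>l\<close> and \<open>r\<close>): the list
  \<open>ds\<close> prescribes which side is extended at each step (\<^term>\<open>True\<close> for the left), and a branch is
  closed as soon as \<open>P\<close> holds or a forbidden square has appeared at one of the two ends. Squares of
  period at most 9, as tested by \<^const>\<open>square_prefix\<close>, turn out to suffice.
\<close>

fun forced :: "(binary list \<Rightarrow> binary list \<Rightarrow> bool) \<Rightarrow> bool list \<Rightarrow>
    binary list \<Rightarrow> binary list \<Rightarrow> bool" where
  "forced P ds l r \<longleftrightarrow> P l r \<or> square_prefix square_roots (l @ r) \<or>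
     square_prefix (map rev square_roots) (rev (l @ r)) \<or>
     (case ds of [] \<Rightarrow> False
      | d # ds' \<Rightarrow> if d then forced P ds' (B0 # l) r \<and> forced P ds' (B1 # l) r
          else forced P ds' l (r @ [B0]) \<and> forced P ds' l (r @ [B1]))"

declare forced.simps [simp del]

lemma few_squares_no_square_prefix:
  assumes w: "few_squares w" and x: "occurs w i x"
  shows "\<not> square_prefix square_roots x" "\<not> square_prefix (map rev square_roots) (rev x)"
proof -
  show "\<not> square_prefix square_roots x"
  proof
    assume "square_prefix square_roots x"
    then obtain y z where "x = y @ y @ z" "y \<noteq> []" "y \<notin> set square_roots"
      using square_prefixD by blast
    with w x show False
      by (auto simp: few_squares_def occurs_append)
  qed
  show "\<not> square_prefix (map rev square_roots) (rev x)"
  proof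
    assume "square_prefix (map rev square_roots) (rev x)"
    then obtain y z where y: "rev x = y @ y @ z" "y \<noteq> []" "y \<notin> set (map rev square_roots)"
      using square_prefixD by blast
    from y(1) have x': "x = rev z @ rev y @ rev y"
      by (metis append.assoc rev_append rev_rev_ident)
    have "rev y \<notin> set square_roots"
      using y(3) by (metis image_eqI rev_rev_ident set_map)
    moreover have "occurs w (i + int (length z)) (rev y @ rev y)"
      using x by (simp add: x' occurs_append)
    ultimately show False
      using w y(2) by (auto simp: few_squares_def)
  qed
qed

text \<open>The letter of \<open>w\<close> at the extended end selects a branch of the search. A
  branch that \<open>w\<close> follows cannot be closed by a forbidden square, so it must be closed
  by \<open>P\<close>.\<close>

lemma forced_sound:
  assumes w: "few_squares w"
    and "forced P ds l r" "occurs w (c - int (length l)) l" "occurs w c r"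
  shows "\<exists>l r. P l r \<and> occurs w (c - int (length l)) l \<and> occurs w c r"
  using assms(2-)
proof (induction ds arbitrary: l r)
  case (Cons d ds)
  have lr: "occurs w (c - int (length l)) (l @ r)"
    using Cons.prems by (simp add: occurs_append)
  show ?case
  proof (cases "P l r")
    case False
    then have rec: "if d then forced P ds (B0 # l) r \<and> forced P ds (B1 # l) r
          else forced P ds l (r @ [B0]) \<and> forced P ds l (r @ [B1])"
      using Cons.prems(1) few_squares_no_square_prefix[OF w lr]
      by (simp add: forced.simps[of _ "d # ds"])
    show ?thesis
    proof (cases d)
      case True
      define b where "b = w (c - int (length l) - 1)"
      have "forced P ds (b # l) r"
        using rec True by (cases b) auto
      moreover have "occurs w (c - int (length (b # l))) (b # l)"
        using Cons.prems(2) by (simp add: b_def algebra_simps)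
      ultimately show ?thesis
        using Cons.IH Cons.prems(3) by blast
    next
      case False
      define b where "b = w (c + int (length r))"
      have "forced P ds l (r @ [b])"
        using rec False by (cases b) auto
      moreover have "occurs w c (r @ [b])"
        using Cons.prems(3) by (simp add: b_def occurs_append)
      ultimately show ?thesis
        using Cons.IH Cons.prems(2) by blast
    qed
  qed (use Cons.prems in blast)
next
  case Nil
  then have "occurs w (c - int (length l)) (l @ r)"
    by (simp add: occurs_append)
  from Nil few_squares_no_square_prefix[OF w this] show ?case
    unfolding forced.simps[of _ "[]"] by auto
qed

text \<open>
  The boundaries between \<open>g4\<close>-blocks are the positions followed by 00 and preceded by one of these
  words: the only other occurrences of 11 followed by 00, inside \<open>g4 T0\<close>, are preceded by 0.
\<close>

definition cut_words :: "binary list list" where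
  "cut_words = [[B1, B0, B1, B1], [B1, B1, B1]]"

definition cuts :: "(int \<Rightarrow> binary) \<Rightarrow> int set" where
  "cuts w = {c. occurs w c [B0, B0] \<and> (\<exists>s \<in> set cut_words. occurs w (c - int (length s)) s)}"

text \<open>The 00 after the block is demanded so that the end of the block is again a cut.\<close>

definition block_right :: "binary list \<Rightarrow> binary list \<Rightarrow> bool" where
  "block_right l r \<longleftrightarrow> list_ex (\<lambda>a. prefix (g4 a @ [B0, B0]) r) [T0, T1, T2]"

definition block_left :: "binary list \<Rightarrow> binary list \<Rightarrow> bool" where
  "block_left l r \<longleftrightarrow>
     list_ex (\<lambda>a. list_ex (\<lambda>s. suffix (s @ g4 a) l) cut_words) [T0, T1, T2]"

definition ends_in_cut :: "binary list \<Rightarrow> binary list \<Rightarrow> bool" where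
  "ends_in_cut l r \<longleftrightarrow> list_ex (\<lambda>s. suffix (s @ [B0, B0]) r) cut_words"

lemma forced_cut: "forced ends_in_cut (replicate 22 False) [] []"
  by code_simp

text \<open>The longest target \<open>g4 T0 @ [B0, B0]\<close> needs 17 letters beyond the initial
  00. The steps to the left and the remaining ones to the right can only close branches by forbidden
  squares.\<close>

lemma forced_right:
  "forced block_right (replicate 4 True @ replicate 20 False) [B1, B0, B1, B1] [B0, B0]"
  "forced block_right (replicate 8 True @ replicate 20 False) [B1, B1, B1] [B0, B0]"
  by code_simp+

text \<open>After 1011 the longest target, 1011 followed by \<open>g4 T0\<close>, needs 17 more
  letters on the left. After 111 only \<open>g4 T2\<close> can match, with at most 6 more; all other
  steps can only close branches by squares.\<close>

lemma forced_left:
  "forced block_left (replicate 18 True) [B1, B0, B1, B1] [B0, B0]"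
  "forced block_left (replicate 8 True @ replicate 8 False) [B1, B1, B1] [B0, B0]"
  by code_simp+

lemma cuts_nonempty:
  assumes w: "few_squares w"
  shows "cuts w \<noteq> {}"
proof -
  obtain r s where s: "s \<in> set cut_words" "suffix (s @ [B0, B0]) r" "occurs w 0 r"
    using forced_sound[OF w forced_cut, of 0] by (auto simp: ends_in_cut_def list_ex_iff)
  then obtain x where "r = x @ s @ [B0, B0]"
    by (auto simp: suffix_def)
  with s(3) have "occurs w (int (length x)) s" "occurs w (int (length x) + int (length s)) [B0, B0]"
    by (simp_all add: occurs_append)
  with s(1) have "int (length x) + int (length s) \<in> cuts w"
    unfolding cuts_def by force
  then show ?thesis by blast
qed

lemma g4_ends_in_cut_word: "\<exists>s \<in> set cut_words. suffix s (g4 a)"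
  by (cases a) (simp_all add: cut_words_def suffix_def)

lemma cuts_next:
  assumes w: "few_squares w" and c: "c \<in> cuts w"
  shows "\<exists>a. occurs w c (g4 a) \<and> c + int (length (g4 a)) \<in> cuts w"
proof -
  obtain s where s: "s \<in> set cut_words" "occurs w (c - int (length s)) s" "occurs w c [B0, B0]"
    using c by (auto simp: cuts_def)
  then obtain ds where "forced block_right ds s [B0, B0]"
    using forced_right by (auto simp: cut_words_def)
  from forced_sound[OF w this s(2,3)]
  obtain r a where r: "occurs w c r" "prefix (g4 a @ [B0, B0]) r"
    unfolding block_right_def list_ex_iff by blast
  then have a: "occurs w c (g4 a)" "occurs w (c + int (length (g4 a))) [B0, B0]"
    using occurs_prefix[OF r] by (simp_all only: occurs_append)
  obtain s' where "s' \<in> set cut_words" "suffix s' (g4 a)"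
    using g4_ends_in_cut_word by blast
  with a occurs_suffix[of w "c + int (length (g4 a))" "g4 a" s'] show ?thesis
    by (auto simp: cuts_def)
qed

lemma cuts_prev:
  assumes w: "few_squares w" and c: "c \<in> cuts w"
  shows "\<exists>a. occurs w (c - int (length (g4 a))) (g4 a) \<and> c - int (length (g4 a)) \<in> cuts w"
proof -
  obtain s where s: "s \<in> set cut_words" "occurs w (c - int (length s)) s" "occurs w c [B0, B0]"
    using c by (auto simp: cuts_def)
  then obtain ds where "forced block_left ds s [B0, B0]"
    using forced_left by (auto simp: cut_words_def)
  from forced_sound[OF w this s(2,3)]
  obtain l a s' where l: "occurs w (c - int (length l)) l" "suffix (s' @ g4 a) l"
      and s': "s' \<in> set cut_words"
    unfolding block_left_def list_ex_iff by blast
  define d where "d = c - int (length (g4 a))"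
  have d: "occurs w (d - int (length s')) s'" "occurs w d (g4 a)"
    using occurs_suffix[OF l] by (simp_all add: d_def occurs_append algebra_simps)
  moreover have "prefix [B0, B0] (g4 a)"
    by (cases a) simp_all
  ultimately have "d \<in> cuts w"
    using s' occurs_prefix unfolding cuts_def by blast
  with d(2) show ?thesis
    by (auto simp: d_def)
qed

lemma length_g4: "5 \<le> length (g4 a)"
  by (cases a) simp_all

lemma few_squares_root_length:
  assumes "few_squares w" "occurs w i v" "sublist (u @ u) v"
  shows "length u \<le> 3"
proof (cases "u = []")
  case False
  moreover obtain j where "occurs w j (u @ u)"
    using occurs_sublist[OF assms(2,3)] by blast
  ultimately have "u \<in> set square_roots"
    using assms(1) by (simp add: few_squares_def)
  then show ?thesis
    by (auto simp: square_roots_def)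
qed simp

lemma few_squares_desubst:
  assumes w: "few_squares w"
  shows "\<exists>t p. desubst g4 w t p \<and> thue_word t"
proof -
  obtain t p where d: "desubst g4 w t p"
    using desubst_exists[OF _ cuts_next[OF w] cuts_prev[OF w]] cuts_nonempty[OF w] by blast
  have no_square: "\<not> occurs t i x"
    if "sublist (u @ u) (concat (map g4 x))" "length u > 3" for i x u
    using few_squares_root_length[OF w _ that(1)] that(2) desubst_occurs[OF d] by fastforce
  have sf: "square_free t"
    unfolding square_free_def
  proof (intro allI impI, rule ccontr)
    fix i u assume u: "occurs t i (u @ u)" "u \<noteq> []"
    then have "length (concat (map g4 u)) > 3"
      using length_g4[of "hd u"] by (cases u) auto
    with u(1) no_square[of "concat (map g4 u)" "u @ u" i] show False
      by simp
  qed
  \<comment> \<open>\<open>g4 T1\<close> is 0001.00111011, where 0001 is also a prefix and 00111011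
    also a suffix of \<open>g4 T0\<close>. Hence the image of 010 contains the square of
    00111011.0001, which starts at offset 9.\<close>
  have "\<not> occurs t i [T0, T1, T0]" for i
    by (rule no_square[of "take 12 (drop 9 (concat (map g4 [T0, T1, T0])))"]) code_simp+
  \<comment> \<open>Likewise with root 00111011.00111.0001, where the middle factor is
    \<open>g4 T2\<close>.\<close>
  moreover have "\<not> occurs t i [T0, T2, T1, T2, T0]" for i
    by (rule no_square[of "take 17 (drop 9 (concat (map g4 [T0, T2, T1, T2, T0])))"]) code_simp+
  then have "\<not> occurs t i [T2, T1, T2]" for i
    using square_free_aba[OF sf] by blast
  ultimately show ?thesis
    using d sf by (auto simp: thue_word_def)
qed

section \<open>Factors\<close>

text \<open>The image of \<open>a\<close> under \<open>g4\<close> after \<open>n\<close> rounds of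
  \<open>hall_thue\<close>. Each new round is applied to the letter first, the form that
  \<open>desubst_compose\<close> delivers.\<close>

fun g4_iter :: "nat \<Rightarrow> ternary \<Rightarrow> binary list" where
  "g4_iter 0 a = g4 a"
| "g4_iter (Suc n) a = concat (map (g4_iter n) (hall_thue a))"

text \<open>Since \<open>hall_thue\<close> sends 2 to the single letter 1, the bound for 2 grows
  only by way of the bound for 1, which therefore has to be larger by one.\<close>

lemma g4_iter_long:
  "n + 2 \<le> length (g4_iter n T0)" "n + 2 \<le> length (g4_iter n T1)" "n + 1 \<le> length (g4_iter n T2)"
  by (induction n) simp_all

lemma length_g4_iter: "n < length (g4_iter n a)"
  using g4_iter_long[of n] by (cases a) simp_all

lemma few_squares_desubst_iter:
  assumes w: "few_squares w"
  shows "\<exists>t p. desubst (g4_iter n) w t p \<and> thue_word t"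
proof (induction n)
  case 0
  have "g4_iter 0 = g4" by auto
  with few_squares_desubst[OF w] show ?case by simp
next
  case (Suc n)
  then obtain t p where t: "desubst (g4_iter n) w t p" "thue_word t" by blast
  obtain s q where s: "desubst hall_thue t s q" "thue_word s"
    using thue_word_desubst[OF t(2)] by blast
  have "g4_iter (Suc n) = (\<lambda>a. concat (map (g4_iter n) (hall_thue a)))" by auto
  with desubst_compose[OF t(1) s(1)] s(2) show ?case by auto
qed

lemma factors_inf_iff: "v \<in> factors_inf s \<longleftrightarrow> (\<exists>x s'. s = x @- v @- s')"
proof
  assume "v \<in> factors_inf s"
  then obtain i n where "v = stake n (sdrop i s)"
    by (auto simp: factors_inf_def)
  then have "s = stake i s @- v @- sdrop n (sdrop i s)"
    by (metis stake_sdrop)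
  then show "\<exists>x s'. s = x @- v @- s'" by blast
next
  assume "\<exists>x s'. s = x @- v @- s'"
  then obtain x s' where "s = x @- v @- s'" by blast
  then have "v = stake (length v) (sdrop (length x) s)"
    by (simp add: stake_shift sdrop_shift)
  then show "v \<in> factors_inf s"
    by (auto simp: factors_inf_def)
qed

text \<open>Because \<open>b3\<close> is fixed by \<open>hall_thue\<close>, the image of a prefix of
  \<open>b3\<close> is again a prefix, and \<open>hall_thue\<close> can be applied \<open>n\<close>
  times before \<open>g4\<close>.\<close>

lemma b3_prefix_image:
  assumes "b3 = x @- s"
  shows "\<exists>s'. morph_inf g4 b3 = concat (map (g4_iter n) x) @- s'"
  using assms
proof (induction n arbitrary: x s)
  case 0
  have "map (g4_iter 0) x = map g4 x" by simp
  with 0 show ?case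
    using morph_inf_shift[of g4 x s, OF g4_ne] by metis
next
  case (Suc n)
  have "b3 = concat (map hall_thue x) @- morph_inf hall_thue s"
    using morph_inf_shift[of hall_thue x s, OF hall_thue_ne]
    unfolding Suc.prems[symmetric] b3_fixed(2) .
  from Suc.IH[OF this]
  obtain s' where "morph_inf g4 b3 = concat (map (g4_iter n) (concat (map hall_thue x))) @- s'"
    by blast
  moreover have "concat (map (g4_iter n) (concat (map hall_thue x))) =
      concat (map (g4_iter (Suc n)) x)"
    by (induction x) auto
  ultimately show ?case by metis
qed

lemma b3_pairs:
  assumes "a \<noteq> b"
  shows "\<exists>x s. b3 = x @- [a, b] @- s"
proof -
  obtain s where "b3 = ht_iter 3 @- s"
    using ht_fixed_prefix[OF b3_fixed] by blast
  \<comment> \<open>Three iterations are enough: 012021012102 contains all six pairs of distinct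
    letters.\<close>
  then have s: "b3 = [T0, T1, T2, T0, T2, T1, T0, T1, T2, T1, T0, T2] @- s"
    by (simp add: ht_iter_0 ht_iter_Suc numeral_3_eq_3)
  have "sublist [a, b] [T0, T1, T2, T0, T2, T1, T0, T1, T2, T1, T0, T2]"
    using assms by (cases a; cases b) (simp_all add: sublist_Cons_right)
  then obtain y z where "[T0, T1, T2, T0, T2, T1, T0, T1, T2, T1, T0, T2] = y @ [a, b] @ z"
    by (auto simp: sublist_def)
  then have "b3 = y @- [a, b] @- z @- s"
    unfolding s by (metis shift_append)
  then show ?thesis by blast
qed

lemma occurs_in_g4_b3:
  assumes w: "few_squares w" and v: "occurs w j v"
  shows "v \<in> factors_inf (morph_inf g4 b3)"
proof -
  \<comment> \<open>With this \<open>n\<close> every block is longer than \<open>v\<close>, so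
    \<open>v\<close> meets at most two consecutive blocks.\<close>
  define n where "n = length v"
  obtain t p where d: "desubst (g4_iter n) w t p" and th: "thue_word t"
    using few_squares_desubst_iter[OF w] by blast
  have len: "length v \<le> length (g4_iter n a)" and ne: "g4_iter n a \<noteq> []" for a
    using length_g4_iter[of n a] by (auto simp: n_def)
  obtain i where i: "sublist v (g4_iter n (t i) @ g4_iter n (t (i + 1)))"
    using desubst_two_blocks[OF d ne len v] by blast
  have "t i \<noteq> t (i + 1)"
    using th square_free_adjacent unfolding thue_word_def by blast
  from b3_pairs[OF this] obtain x s where "b3 = (x @ [t i, t (i + 1)]) @- s"
    unfolding shift_append by blast
  from b3_prefix_image[OF this, of n]
  obtain s' where s': "morph_inf g4 b3 =
      concat (map (g4_iter n) x) @- (g4_iter n (t i) @ g4_iter n (t (i + 1))) @- s'"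
    by auto
  obtain y z where "g4_iter n (t i) @ g4_iter n (t (i + 1)) = y @ v @ z"
    using i by (auto simp: sublist_def)
  then have "morph_inf g4 b3 = (concat (map (g4_iter n) x) @ y) @- v @- z @- s'"
    unfolding s' by simp
  then show ?thesis
    unfolding factors_inf_iff by blast
qed

lemma g4_b3_factor_occurs:
  assumes w: "few_squares w" and v: "v \<in> factors_inf (morph_inf g4 b3)"
  shows "\<exists>j. occurs w j v"
proof -
  obtain x s where xs: "morph_inf g4 b3 = x @- v @- s"
    using v by (auto simp: factors_inf_iff)
  \<comment> \<open>With this \<open>n\<close> the image of the initial 0 of \<open>b3\<close>, a
    prefix of \<open>g4(b3)\<close>, is long enough to contain the given occurrence of
    \<open>v\<close>.\<close>
  define n where "n = length (x @ v)"
  obtain t p where d: "desubst (g4_iter n) w t p" and th: "thue_word t"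
    using few_squares_desubst_iter[OF w] by blast
  obtain i where i: "t i = T0"
    using th square_free_T0 by (auto simp: thue_word_def)
  have "b3 = [T0] @- stl b3"
    using b3_fixed(1) by (metis shift.simps stream.collapse)
  from b3_prefix_image[OF this, of n]
  obtain s' where s': "morph_inf g4 b3 = g4_iter n T0 @- s'" by auto
  have "x @ v = stake n (g4_iter n T0 @- s')"
    using xs s' by (metis n_def shift_append stake_shift_length)
  also have "\<dots> = take n (g4_iter n T0)"
    using length_g4_iter[of n T0] by (simp add: stake_shift)
  finally have "g4_iter n T0 = x @ v @ drop n (g4_iter n T0)"
    by (metis append.assoc append_take_drop_id)
  then have "sublist v (g4_iter n T0)"
    unfolding sublist_def by blast
  moreover have "occurs w (p i) (g4_iter n T0)"
    using d i by (auto simp: desubst_def) metis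
  ultimately show ?thesis
    using occurs_sublist by blast
qed

theorem theorem2:
  fixes w :: "int \<Rightarrow> binary"
  assumes "\<And>x. x \<in> factors_biinf w \<Longrightarrow> is_square x \<Longrightarrow>
    x \<in> {[B0, B0], [B1, B1], [B0, B0, B1, B0, B0, B1], [B1, B1, B0, B1, B1, B0]}"
  shows "factors_biinf w = factors_inf (morph_inf g4 b3)"
proof -
  have "few_squares w"
    unfolding few_squares_def
  proof (intro allI impI)
    fix i u assume u: "u \<noteq> []" "occurs w i (u @ u)"
    then have "u @ u \<in> {[B0] @ [B0], [B1] @ [B1], [B0, B0, B1] @ [B0, B0, B1],
        [B1, B1, B0] @ [B1, B1, B0]}"
      using assms[of "u @ u"] by (auto simp: factors_biinf_occurs is_square_def)
    moreover have "u @ u = x @ x \<longleftrightarrow> u = x" for x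
      by (auto simp: append_eq_append_conv_if dest: arg_cong[of _ _ length])
    ultimately show "u \<in> set square_roots"
      by (simp only: square_roots_def list.set insert_iff empty_iff)
  qed
  then show ?thesis
    using occurs_in_g4_b3 g4_b3_factor_occurs by (auto simp: factors_biinf_occurs)
qed

end
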